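(* Consider the mixed-type functional differential equation (MFDE) $$\dot{x}(t)=a(t)x(t)+b(t)x(t-1)+c(t)x(t+1),$$ and let $F$ be a primitive of the function $a(t)$. If $b(t)=-e^{F(t+1)}$ and $c(t)=e^{F(t-1)}$, then the analytical solution of this non-autonomous MFDE is given by $x(t)=e^{F(t)}$.
   Context: Here $x(t)$ is a real single-valued function (the unknown), and the coefficients $a(t)$, $b(t)$, $c(t)$ are known functions on $\mathbb{R}$. A primitive $F$ of $a$ is a function with $F'=a$. The equation is called autonomous when the coefficients $a,b,c$ are constant, and non-autonomous if at least one of them is not a constant function. It is called mixed-type because it has both a delayed argument $t-1$ and an advanced argument $t+1$. *)

theory Defs
  imports "HOL-Analysis.Analysis"
begin

definition primitive :: "(real \<Rightarrow> real) \<Rightarrow> (real \<Rightarrow> real) \<Rightarrow> bool" where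
  "primitive F a \<longleftrightarrow> (\<forall>t. (F has_real_derivative a t) (at t))"

definition mfde_solution ::
  "(real \<Rightarrow> real) \<Rightarrow> (real \<Rightarrow> real) \<Rightarrow> (real \<Rightarrow> real) \<Rightarrow> (real \<Rightarrow> real) \<Rightarrow> bool" where
  "mfde_solution a b c x \<longleftrightarrow>
     (\<forall>t. (x has_real_derivative (a t * x t + b t * x (t - 1) + c t * x (t + 1))) (at t))"

definition autonomous :: "(real \<Rightarrow> real) \<Rightarrow> (real \<Rightarrow> real) \<Rightarrow> (real \<Rightarrow> real) \<Rightarrow> bool" where
  "autonomous a b c \<longleftrightarrow> a constant_on UNIV \<and> b constant_on UNIV \<and> c constant_on UNIV"

end

theory Submission
  imports Defs
begin

text \<open>Each coefficient carries the value of \<open>exp (F _)\<close> at the other's shifted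
  argument, so the delayed and advanced terms are the same product with opposite signs and cancel.
  What remains is x' = a x, solved by \<open>exp (F t)\<close> via the chain rule.\<close>

theorem proposition3p1:
  fixes a b c F :: "real \<Rightarrow> real"
  assumes "primitive F a"
    and "\<And>t. b t = - exp (F (t + 1))"
    and "\<And>t. c t = exp (F (t - 1))"
    and "\<not> autonomous a b c"
  shows "mfde_solution a b c (\<lambda>t. exp (F t))"
  unfolding mfde_solution_def
proof
  fix t
  have "b t * exp (F (t - 1)) + c t * exp (F (t + 1)) = 0"
    by (simp add: assms(2,3))
  moreover have "(F has_real_derivative a t) (at t)"
    using assms(1) by (simp add: primitive_def)
  then have "((\<lambda>t. exp (F t)) has_real_derivative exp (F t) * a t) (at t)"
    by (rule DERIV_fun_exp)
  ultimately show "((\<lambda>t. exp (F t)) has_real_derivative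
      a t * exp (F t) + b t * exp (F (t - 1)) + c t * exp (F (t + 1))) (at t)"
    \<comment> \<open>\<open>add.assoc\<close> groups the two shifted terms into the vanishing sum,
      leaving only \<open>a t * exp (F t)\<close>.\<close>
    by (simp add: add.assoc mult.commute)
qed

end
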